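(* Let $G=(S,T;E)$ with $S=\{s_1,\dots,s_n\}$, $w:E\to\mathbb R_+$, $d\in\mathbb Z_+$ and $\theta\in\mathbb R$. Let $x$ be an optimal solution of (LP1) and let $e_1,\dots,e_m$ be an ordering of $E$ that is $\theta$-flat with respect to $x$. Consider the recursive procedure $\textsc{WdmLpApx}(F,c)$, for $F\subseteq E$ and $c:E\to\mathbb R$: first delete from $F$ all edges $e$ with $c(e)\le0$; if $F=\emptyset$, return $\emptyset$; otherwise let $st$ ($s\in S,t\in T$) be the first edge of $F$ in the ordering $e_1,\dots,e_m$, compute $M'=\textsc{WdmLpApx}(F\setminus\{st\},c')$ where $c'=c-c(st)\,\chi_{\Delta(s)\cup\{s't\in\Delta(t):\,s'\in R_d(s)\}}$, and return $M'\cup\{st\}$ if this is a $d$-distance matching and $M'$ otherwise. Then $M=\textsc{WdmLpApx}(E,w)$ is a $d$-distance matching with $\theta\, w(M)\ge w(M^* )$ for every $d$-distance matching $M^*$ of $G$; i.e., the procedure is a $\theta$-approximation algorithm.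
   Context: $G$ is a finite bipartite graph without loops or parallel edges; the nodes of $S$ are in the fixed order $s_1,\dots,s_n$. A $d$-distance matching is a subset $M\subseteq E$ such that every node of $S$ is incident to at most one edge of $M$, and whenever $s_it,s_jt\in M$ with $i\ne j$, $t\in T$, we have $|j-i|\ge d$; $w(M)=\sum_{e\in M}w(e)$. $\Delta(v)$ is the set of edges incident to $v$, $\chi_Z$ is the characteristic vector of $Z\subseteq E$, $R_d(s_i)=\{s_i,\dots,s_{\min(i+d-1,n)}\}$ and $L_d(s_i)=\{s_{\max(i-d+1,1)},\dots,s_i\}$. (LP1): maximize $\sum_{st\in E}w_{st}x_{st}$ subject to $x\in\mathbb R_+^E$, $\sum_{st\in\Delta(s)}x_{st}\le1$ ($s\in S$), $\sum_{s't\in E:\,s'\in R_d(s)}x_{s't}\le1$ ($s\in S,t\in T$). An ordering $e_1=s^1t^1,\dots,e_m=s^mt^m$ of $E$ is $\theta$-flat with respect to $x$ if for each $i$, $\xi_i+\bar\xi_i\le\theta-x_{e_i}$, where $\xi_i=\sum\{x_{e_j}:j>i,\ e_j\in\Delta(s^i)\}$ and $\bar\xi_i=\sum\{x_{e_j}:j>i,\ e_j\in\Delta(t^i),\ s^j\in L_d(s^i)\cup R_d(s^i)\}$.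
   Formalization: The weight is reduced on Δ(s) ∪ {s't ∈ Δ(t): s' ∈ L_d(s) ∪ R_d(s)} instead of only s' ∈ R_d(s); with R_d(s) alone the claim fails, e.g. d=2, edges s_1t, s_2t of weights 1, 2, x=(0,1), ordering s_2t, s_1t, θ=1. *)

theory Defs
  imports Complex_Main "HOL-Library.Indicator_Function"
begin

text \<open>
  The node \<open>s\<^sub>i\<close> of \<open>S\<close> is represented by its index \<open>i \<in> {1..n}\<close> and an edge \<open>s\<^sub>it\<close> by the
  pair \<open>(i, t)\<close>.  So a set of pairs is automatically a bipartite graph without loops or
  parallel edges.  Functions on edges are total; only their values on \<open>E\<close> matter.
\<close>

type_synonym 't edge = "nat \<times> 't"

definition bipartite_graph :: "nat \<Rightarrow> 't set \<Rightarrow> 't edge set \<Rightarrow> bool" where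
  "bipartite_graph n T E \<longleftrightarrow> finite T \<and> E \<subseteq> {1..n} \<times> T"

definition Delta_S :: "'t edge set \<Rightarrow> nat \<Rightarrow> 't edge set" where
  "Delta_S E s = {e \<in> E. fst e = s}"

definition Delta_T :: "'t edge set \<Rightarrow> 't \<Rightarrow> 't edge set" where
  "Delta_T E t = {e \<in> E. snd e = t}"

text \<open>For \<open>i \<ge> 1\<close> the truncated subtractions below agree with the integer ones (after
  \<open>max\<close> with 1 in the case of \<open>L\<^sub>d\<close>); for \<open>d = 0\<close> both sets are empty.\<close>

definition R_window :: "nat \<Rightarrow> nat \<Rightarrow> nat \<Rightarrow> nat set" where
  "R_window n d i = {i..min (i + d - 1) n}"

definition L_window :: "nat \<Rightarrow> nat \<Rightarrow> nat set" where
  "L_window d i = {max (i + 1 - d) 1..i}"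

definition distance_matching :: "nat \<Rightarrow> nat \<Rightarrow> 't edge set \<Rightarrow> 't edge set \<Rightarrow> bool" where
  "distance_matching n d E M \<longleftrightarrow>
     M \<subseteq> E \<and>
     (\<forall>s\<in>{1..n}. card (Delta_S M s) \<le> 1) \<and>
     (\<forall>i j t. (i, t) \<in> M \<and> (j, t) \<in> M \<and> i \<noteq> j \<longrightarrow> int d \<le> \<bar>int j - int i\<bar>)"

definition LP1_feasible :: "nat \<Rightarrow> nat \<Rightarrow> 't set \<Rightarrow> 't edge set \<Rightarrow> ('t edge \<Rightarrow> real) \<Rightarrow> bool" where
  "LP1_feasible n d T E x \<longleftrightarrow>
     (\<forall>e\<in>E. 0 \<le> x e) \<and>
     (\<forall>s\<in>{1..n}. (\<Sum>e\<in>Delta_S E s. x e) \<le> 1) \<and>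
     (\<forall>s\<in>{1..n}. \<forall>t\<in>T. (\<Sum>e\<in>{e \<in> Delta_T E t. fst e \<in> R_window n d s}. x e) \<le> 1)"

definition LP1_optimal ::
  "nat \<Rightarrow> nat \<Rightarrow> 't set \<Rightarrow> 't edge set \<Rightarrow> ('t edge \<Rightarrow> real) \<Rightarrow> ('t edge \<Rightarrow> real) \<Rightarrow> bool" where
  "LP1_optimal n d T E w x \<longleftrightarrow>
     LP1_feasible n d T E x \<and>
     (\<forall>y. LP1_feasible n d T E y \<longrightarrow> (\<Sum>e\<in>E. w e * y e) \<le> (\<Sum>e\<in>E. w e * x e))"

definition edge_ordering :: "'t edge set \<Rightarrow> 't edge list \<Rightarrow> bool" where
  "edge_ordering E es \<longleftrightarrow> distinct es \<and> set es = E"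

text \<open>Positions in an ordering are counted from 0: \<open>es ! i\<close> is \<open>e\<^bsub>i+1\<^esub>\<close>.\<close>

definition xi :: "'t edge set \<Rightarrow> 't edge list \<Rightarrow> ('t edge \<Rightarrow> real) \<Rightarrow> nat \<Rightarrow> real" where
  "xi E es x i =
     (\<Sum>j\<in>{j. i < j \<and> j < length es \<and> es ! j \<in> Delta_S E (fst (es ! i))}. x (es ! j))"

definition xi_bar ::
  "nat \<Rightarrow> nat \<Rightarrow> 't edge set \<Rightarrow> 't edge list \<Rightarrow> ('t edge \<Rightarrow> real) \<Rightarrow> nat \<Rightarrow> real" where
  "xi_bar n d E es x i =
     (\<Sum>j\<in>{j. i < j \<and> j < length es \<and> es ! j \<in> Delta_T E (snd (es ! i)) \<and>
              fst (es ! j) \<in> L_window d (fst (es ! i)) \<union> R_window n d (fst (es ! i))}. x (es ! j))"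

definition flat_ordering ::
  "nat \<Rightarrow> nat \<Rightarrow> 't edge set \<Rightarrow> ('t edge \<Rightarrow> real) \<Rightarrow> real \<Rightarrow> 't edge list \<Rightarrow> bool" where
  "flat_ordering n d E x \<theta> es \<longleftrightarrow>
     edge_ordering E es \<and>
     (\<forall>i<length es. xi E es x i + xi_bar n d E es x i \<le> \<theta> - x (es ! i))"

text \<open>
  The first edge of \<open>F'\<close> in the ordering is the head of the filtered list, which is empty
  exactly if \<open>F'\<close> is, as long as \<open>F \<subseteq> set es\<close>.

  The weight is reduced on all edges at \<open>t\<close> that conflict with \<open>st\<close>, that is, on both sides
  \<open>L\<^sub>d(s) \<union> R\<^sub>d(s)\<close>, as in the definition of flatness.  Reducing it on \<open>R\<^sub>d(s)\<close> only is not
  sufficient for an arbitrary flat ordering: for \<open>d = 2\<close>, edges \<open>s\<^sub>1t\<close> of weight 1 and \<open>s\<^sub>2t\<close>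
  of weight 2, and the ordering \<open>s\<^sub>2t, s\<^sub>1t\<close>, which is 1-flat for the (LP1) optimum
  \<open>(0, 1)\<close>, the one-sided procedure returns \<open>{s\<^sub>1t}\<close>, of weight 1 instead of 2.
\<close>

function wdm_lp_apx ::
  "nat \<Rightarrow> nat \<Rightarrow> 't edge set \<Rightarrow> 't edge list \<Rightarrow> 't edge set \<Rightarrow> ('t edge \<Rightarrow> real) \<Rightarrow> 't edge set" where
  "wdm_lp_apx n d E es F c =
     (let F' = {e \<in> F. \<not> c e \<le> 0} in
      case filter (\<lambda>e. e \<in> F') es of
        [] \<Rightarrow> {}
      | st # _ \<Rightarrow>
          (let s = fst st; t = snd st;
               Z = Delta_S E s \<union> {e \<in> Delta_T E t. fst e \<in> L_window d s \<union> R_window n d s};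
               c' = (\<lambda>e. c e - c st * indicat_real Z e);
               M' = wdm_lp_apx n d E es (F' - {st}) c'
           in if distance_matching n d E (M' \<union> {st}) then M' \<union> {st} else M'))"
  by pat_completeness auto
termination
proof (relation "measure (\<lambda>(n, d, E, es, F, c). card (F \<inter> set es))", goal_cases)
  case 1
  show ?case by simp
next
  case (2 n d E es F c F' st)
  then have "st \<in> F \<inter> set es" and "F' \<subseteq> F"
    by (auto simp: filter_eq_Cons_iff)
  then show ?case
    by (auto intro!: psubset_card_mono)
qed

declare wdm_lp_apx.simps [simp del]

end

theory Submission
  imports Defs
begin

text \<open>
  A local-ratio argument. Let \<open>Z\<close> be the set of edges whose weight is reduced in a step with
  first edge \<open>st\<close>. Flatness bounds the LP mass of the remaining edges in \<open>Z\<close> by \<open>\<theta>\<close>, because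
  all of them come no earlier than \<open>st\<close> in the ordering. On the other hand the returned matching
  always meets \<open>Z\<close>: either it contains \<open>st\<close>, or \<open>st\<close> was rejected because of an edge in \<open>Z\<close>.
  Hence \<open>\<theta>\<close> times the weight of the returned matching dominates the LP value with respect to
  the part of the weight removed in this step, and by induction with respect to the whole
  weight. The LP value in turn dominates every matching, whose characteristic vector is feasible.
\<close>

section \<open>Conflict sets and the recursion of the procedure\<close>

definition conflicts :: "nat \<Rightarrow> nat \<Rightarrow> 't edge set \<Rightarrow> 't edge \<Rightarrow> 't edge set" where
  "conflicts n d E e =
     Delta_S E (fst e) \<union>
     {f \<in> Delta_T E (snd e). fst f \<in> L_window d (fst e) \<union> R_window n d (fst e)}"

lemma bipartite_graph_finite: "bipartite_graph n T E \<Longrightarrow> finite E"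
  unfolding bipartite_graph_def by (meson finite_SigmaI finite_atLeastAtMost finite_subset)

lemma wdm_lp_apx_Nil:
  assumes "filter (\<lambda>e. e \<in> F \<and> c e > 0) es = []"
  shows "wdm_lp_apx n d E es F c = {}"
proof -
  have "filter (\<lambda>e. e \<in> {e \<in> F. \<not> c e \<le> 0}) es = []"
    using assms by (simp add: not_le)
  then show ?thesis
    by (subst wdm_lp_apx.simps) simp
qed

lemma wdm_lp_apx_Cons:
  assumes "filter (\<lambda>e. e \<in> F \<and> c e > 0) es = st # r"
  shows "wdm_lp_apx n d E es F c =
     (let M' = wdm_lp_apx n d E es ({e \<in> F. c e > 0} - {st})
                 (\<lambda>e. c e - c st * indicat_real (conflicts n d E st) e)
      in if distance_matching n d E (insert st M') then insert st M' else M')"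
proof -
  have "filter (\<lambda>e. e \<in> {e \<in> F. \<not> c e \<le> 0}) es = st # r"
    using assms by (simp add: not_le)
  then show ?thesis
    by (subst wdm_lp_apx.simps) (simp add: Let_def conflicts_def not_le)
qed

text \<open>Only \<open>F\<close> and \<open>c\<close> change along the recursion, so the induction
  fixes everything else and splits on whether a live edge exists. The first live edge leaves
  \<open>F\<close> and lies in \<open>set es\<close>; \<open>F\<close> itself may be infinite, hence
  the measure \<open>card (F \<inter> set es)\<close>.\<close>

lemma wdm_lp_apx_induct [case_names Nil Cons]:
  assumes "\<And>F c. filter (\<lambda>e. e \<in> F \<and> c e > 0) es = [] \<Longrightarrow> P F c"
    and "\<And>F c st r. \<lbrakk>filter (\<lambda>e. e \<in> F \<and> c e > 0) es = st # r;
           P ({e \<in> F. c e > 0} - {st})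
             (\<lambda>e. c e - c st * indicat_real (conflicts n d E st) e)\<rbrakk> \<Longrightarrow> P F c"
  shows "P F c"
proof (induction "card (F \<inter> set es)" arbitrary: F c rule: less_induct)
  case (less F c)
  show ?case
  proof (cases "filter (\<lambda>e. e \<in> F \<and> c e > 0) es")
    case Nil
    then show ?thesis by (rule assms(1))
  next
    case (Cons st r)
    then have "st \<in> F \<inter> set es"
      by (auto simp: filter_eq_Cons_iff)
    then have "card (({e \<in> F. c e > 0} - {st}) \<inter> set es) < card (F \<inter> set es)"
      by (auto intro!: psubset_card_mono)
    then show ?thesis
      by (rule assms(2)[OF Cons less(1)])
  qed
qed

section \<open>The output as a distance matching inside \<open>F\<close>\<close>

lemma distance_matching_empty: "distance_matching n d E {}"
  by (simp add: distance_matching_def Delta_S_def)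

lemma distance_matching_wdm_lp_apx: "distance_matching n d E (wdm_lp_apx n d E es F c)"
proof (induction F c rule: wdm_lp_apx_induct[where es = es and n = n and d = d and E = E])
  case (Nil F c)
  then show ?case
    by (simp add: wdm_lp_apx_Nil distance_matching_empty)
next
  case (Cons F c st r)
  then show ?case
    by (simp add: wdm_lp_apx_Cons[OF Cons(1)] Let_def)
qed

lemma wdm_lp_apx_subset: "wdm_lp_apx n d E es F c \<subseteq> F"
proof (induction F c rule: wdm_lp_apx_induct[where es = es and n = n and d = d and E = E])
  case (Nil F c)
  then show ?case
    by (simp add: wdm_lp_apx_Nil)
next
  case (Cons F c st r)
  from Cons(1) have "st \<in> F"
    by (auto simp: filter_eq_Cons_iff)
  with Cons(2) show ?case
    by (auto simp: wdm_lp_apx_Cons[OF Cons(1)] Let_def)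
qed

text \<open>Justifies that a rejected edge is always blocked by a member of its conflict set. Both
  windows are needed in that set: an edge of \<open>M\<close> at the same node of \<open>T\<close>
  may come before or after \<open>e\<close> on the \<open>S\<close> side.\<close>

lemma distance_matching_insert:
  assumes graph: "bipartite_graph n T E"
    and M: "distance_matching n d E M"
    and "e \<in> E" "M \<inter> conflicts n d E e = {}"
  shows "distance_matching n d E (insert e M)"
proof -
  have ME: "M \<subseteq> E" and card_M: "\<forall>s\<in>{1..n}. card (Delta_S M s) \<le> 1"
    and dist_M: "\<And>i j t. (i, t) \<in> M \<Longrightarrow> (j, t) \<in> M \<Longrightarrow> i \<noteq> j \<Longrightarrow> int d \<le> \<bar>int j - int i\<bar>"
    using M unfolding distance_matching_def by blast+
  obtain s t where e: "e = (s, t)" by fastforce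
  have disj: "f \<notin> conflicts n d E e" if "f \<in> M" for f
    using assms(4) that by blast
  have card: "card (Delta_S (insert e M) s') \<le> 1" if "s' \<in> {1..n}" for s'
  proof (cases "s' = s")
    case True
    have "fst f \<noteq> s" if "f \<in> M" for f
      using disj[OF that] ME that by (auto simp: conflicts_def Delta_S_def e)
    then have "Delta_S (insert e M) s' = {e}"
      using True by (auto simp: Delta_S_def e)
    then show ?thesis by simp
  next
    case False
    then have "Delta_S (insert e M) s' = Delta_S M s'"
      by (auto simp: Delta_S_def e)
    then show ?thesis using card_M that by simp
  qed
  have far: "int d \<le> \<bar>int j - int s\<bar>" if "(j, t) \<in> M" for j
  proof -
    \<comment> \<open>The windows are cut off at 1 and \<open>n\<close>. Since \<open>j\<close> lies
      in this range, being outside both windows really means distance at least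
      \<open>d\<close>.\<close>
    have "j \<in> {1..n}"
      using graph ME that by (auto simp: bipartite_graph_def)
    moreover have "j \<notin> L_window d s \<union> R_window n d s"
      using disj[OF that] ME that by (auto simp: conflicts_def Delta_T_def e)
    ultimately show ?thesis
      by (auto simp: L_window_def R_window_def)
  qed
  have "int d \<le> \<bar>int j - int i\<bar>"
    if "(i, u) \<in> insert e M" "(j, u) \<in> insert e M" "i \<noteq> j" for i j u
    using that far[of i] far[of j] dist_M[of i u j] by (auto simp: e abs_minus_commute)
  then show ?thesis
    unfolding distance_matching_def using card ME \<open>e \<in> E\<close> by blast
qed

section \<open>Flatness and the local-ratio bound\<close>

lemma sum_nth_later:
  assumes "distinct (us @ a # vs)"
  shows "(\<Sum>j\<in>{j. length us < j \<and> j < length (us @ a # vs) \<and> P ((us @ a # vs) ! j)}.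
            f ((us @ a # vs) ! j)) = sum f {e \<in> set vs. P e}"
proof (rule sum.reindex_bij_betw)
  let ?es = "us @ a # vs" and ?J = "{j. length us < j \<and> j < length (us @ a # vs) \<and> P ((us @ a # vs) ! j)}"
  have "inj_on ((!) ?es) ?J"
    using assms by (auto intro!: inj_on_nth)
  moreover have "(!) ?es ` ?J = {e \<in> set vs. P e}"
  proof (intro equalityI subsetI)
    fix e assume "e \<in> {e \<in> set vs. P e}"
    then obtain k where "k < length vs" "e = vs ! k" "P e"
      by (auto simp: in_set_conv_nth)
    then show "e \<in> (!) ?es ` ?J"
      \<comment> \<open>The pivot \<open>a\<close> occupies position \<open>length us\<close>, so
        entry \<open>k\<close> of \<open>vs\<close> sits one further.\<close>
      by (intro image_eqI[where x = "length us + Suc k"]) (auto simp: nth_append)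
  qed (auto simp: nth_append nth_Cons')
  ultimately show "bij_betw ((!) ?es) ?J {e \<in> set vs. P e}"
    by (simp add: bij_betw_def)
qed

text \<open>\<open>P\<close> marks the live edges. Edges before \<open>st\<close> fail
  \<open>P\<close>, so every live conflict is \<open>st\<close> itself or a later edge, and the
  later ones are counted by \<open>xi\<close> or \<open>xi_bar\<close> at the position of
  \<open>st\<close>.\<close>

lemma flat_ordering_conflicts:
  assumes flat: "flat_ordering n d E x \<theta> es"
    and nonneg: "\<forall>e\<in>E. 0 \<le> x e"
    and first: "filter P es = st # r"
  shows "sum x {e \<in> conflicts n d E st. P e} \<le> \<theta>"
proof -
  obtain us vs where es: "es = us @ st # vs" and us: "\<forall>u\<in>set us. \<not> P u"
    using first by (auto simp: filter_eq_Cons_iff)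
  have dist: "distinct es" and E: "set es = E"
    using flat by (auto simp: flat_ordering_def edge_ordering_def)
  let ?A = "{e \<in> set vs. e \<in> Delta_S E (fst st)}"
  let ?B = "{e \<in> set vs. e \<in> Delta_T E (snd st) \<and>
              fst e \<in> L_window d (fst st) \<union> R_window n d (fst st)}"
  have st: "es ! length us = st" by (simp add: es)
  have xi: "xi E es x (length us) = sum x ?A"
    unfolding xi_def st unfolding es
    by (rule sum_nth_later) (use dist es in simp)
  have xi_bar: "xi_bar n d E es x (length us) = sum x ?B"
    unfolding xi_bar_def st unfolding es
    by (rule sum_nth_later) (use dist es in simp)
  have nonneg': "0 \<le> x e" if "e \<in> insert st (?A \<union> ?B)" for e
    using that nonneg E es by auto
  have "{e \<in> conflicts n d E st. P e} \<subseteq> insert st (?A \<union> ?B)"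
    using us E es by (auto simp: conflicts_def Delta_S_def Delta_T_def)
  then have "sum x {e \<in> conflicts n d E st. P e} \<le> sum x (insert st (?A \<union> ?B))"
    using nonneg' by (intro sum_mono2) auto
  also have "\<dots> = x st + sum x (?A \<union> ?B)"
    using dist es by (intro sum.insert) auto
  \<comment> \<open>Counting a common edge twice can only increase the sum, because \<open>x\<close>
    is nonnegative.\<close>
  also have "sum x (?A \<union> ?B) \<le> sum x ?A + sum x ?B"
  proof -
    have "sum x (?A \<union> ?B) + sum x (?A \<inter> ?B) = sum x ?A + sum x ?B"
      by (intro sum.union_inter) auto
    moreover have "0 \<le> sum x (?A \<inter> ?B)"
      by (intro sum_nonneg nonneg') auto
    ultimately show ?thesis by linarith
  qed
  also have "x st + (sum x ?A + sum x ?B) \<le> \<theta>"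
  proof -
    have "length us < length es" by (simp add: es)
    then have "xi E es x (length us) + xi_bar n d E es x (length us) \<le> \<theta> - x (es ! length us)"
      using flat unfolding flat_ordering_def by blast
    then show ?thesis
      unfolding xi xi_bar st by linarith
  qed
  finally show ?thesis by simp
qed

text \<open>Stated for all \<open>F\<close> and \<open>c\<close> because the recursion shrinks
  \<open>F\<close> and may make weights negative. The weight splits as \<open>c'\<close> plus
  \<open>c st\<close> times the indicator of \<open>Z\<close>: induction handles the first summand,
  flatness together with a nonempty \<open>M \<inter> Z\<close> the second.\<close>

lemma wdm_lp_apx_ge_LP_value:
  assumes graph: "bipartite_graph n T E"
    and flat: "flat_ordering n d E x \<theta> es"
    and nonneg: "\<forall>e\<in>E. 0 \<le> x e"
    and "F \<subseteq> E"
  shows "(\<Sum>e\<in>F. c e * x e) \<le> \<theta> * (\<Sum>e\<in>wdm_lp_apx n d E es F c. c e)"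
  using \<open>F \<subseteq> E\<close>
proof (induction F c rule: wdm_lp_apx_induct[where es = es and n = n and d = d and E = E])
  case (Nil F c)
  have "c e \<le> 0" "0 \<le> x e" if "e \<in> F" for e
    using Nil that flat nonneg
    by (auto simp: filter_empty_conv flat_ordering_def edge_ordering_def not_less)
  then have "(\<Sum>e\<in>F. c e * x e) \<le> 0"
    by (intro sum_nonpos mult_nonpos_nonneg)
  then show ?case
    using Nil by (simp add: wdm_lp_apx_Nil)
next
  case (Cons F c st r)
  define F' where "F' = {e \<in> F. c e > 0}"
  define Z where "Z = conflicts n d E st"
  define c' where "c' = (\<lambda>e. c e - c st * indicat_real Z e)"
  define M' where "M' = wdm_lp_apx n d E es (F' - {st}) c'"
  define M where "M = wdm_lp_apx n d E es F c"
  have finE: "finite E" using graph by (rule bipartite_graph_finite)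
  have F'E: "F' \<subseteq> E" using Cons(3) by (auto simp: F'_def)
  have st: "st \<in> F'"
    using Cons(1) by (auto simp: F'_def filter_eq_Cons_iff)
  then have "st \<in> Z" and cst: "c st > 0" and "st \<in> E"
    using F'E by (auto simp: Z_def conflicts_def Delta_S_def F'_def)
  then have c'st: "c' st = 0" by (simp add: c'_def)
  have M'_sub: "M' \<subseteq> F' - {st}"
    unfolding M'_def by (rule wdm_lp_apx_subset)
  have finF': "finite F'" and finM': "finite M'"
    using finE F'E M'_sub by (auto intro: finite_subset)
  have M: "M = (if distance_matching n d E (insert st M') then insert st M' else M')"
    unfolding M_def wdm_lp_apx_Cons[OF Cons(1)]
    by (simp add: Let_def M'_def F'_def c'_def Z_def)
  have finM: "finite M" using finM' by (simp add: M)
  have IH: "(\<Sum>e\<in>F' - {st}. c' e * x e) \<le> \<theta> * sum c' M'"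
    using Cons(2) F'E unfolding M'_def c'_def F'_def Z_def by blast
  have mass: "sum x (F' \<inter> Z) \<le> \<theta>"
  proof -
    have "F' \<inter> Z = {e \<in> conflicts n d E st. e \<in> F \<and> c e > 0}"
      by (auto simp: F'_def Z_def)
    then show ?thesis
      using flat_ordering_conflicts[OF flat nonneg Cons(1)] by simp
  qed
  \<comment> \<open>The sign of \<open>\<theta>\<close> follows from the mass bound; it is needed to
    multiply \<open>meet\<close> by \<open>c st * \<theta>\<close>.\<close>
  have "0 \<le> sum x (F' \<inter> Z)"
    using nonneg F'E by (intro sum_nonneg) auto
  with mass have \<theta>: "0 \<le> \<theta>" by linarith
  have "M \<inter> Z \<noteq> {}"
  proof (cases "distance_matching n d E (insert st M')")
    case True
    then show ?thesis using \<open>st \<in> Z\<close> by (auto simp: M)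
  next
    \<comment> \<open>\<open>M'\<close> is already a distance matching, so if it avoided
      \<open>Z\<close>, then \<open>st\<close> could have been inserted.\<close>
    case False
    moreover have "distance_matching n d E M'"
      unfolding M'_def by (rule distance_matching_wdm_lp_apx)
    ultimately show ?thesis
      using distance_matching_insert[OF graph _ \<open>st \<in> E\<close>] by (auto simp: M Z_def)
  qed
  then have meet: "1 \<le> real (card (M \<inter> Z))"
    using finM by (simp add: Suc_leI card_gt_0_iff)
  \<comment> \<open>Used twice: with \<open>g = x\<close> on \<open>F'\<close> for the LP value and
    with \<open>g = 1\<close> on \<open>M\<close> for the matching weight.\<close>
  have split: "(\<Sum>e\<in>A. c e * g e) = (\<Sum>e\<in>A. c' e * g e) + c st * sum g (A \<inter> Z)"
    if "finite A" for A and g :: "'a edge \<Rightarrow> real"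
  proof -
    have "(\<Sum>e\<in>A. c e * g e) = (\<Sum>e\<in>A. c' e * g e + c st * (g e * indicat_real Z e))"
      by (intro sum.cong) (auto simp: c'_def algebra_simps)
    also have "\<dots> = (\<Sum>e\<in>A. c' e * g e) + c st * (\<Sum>e\<in>A. g e * indicat_real Z e)"
      by (simp add: sum.distrib sum_distrib_left)
    finally show ?thesis
      using that by simp
  qed
  \<comment> \<open>Deleting edges of nonpositive weight cannot lower the LP value.\<close>
  have "(\<Sum>e\<in>F. c e * x e) \<le> (\<Sum>e\<in>F'. c e * x e)"
  proof -
    have "finite F" using Cons(3) finE finite_subset by blast
    then have "(\<Sum>e\<in>F. c e * x e) = (\<Sum>e\<in>F'. c e * x e) + (\<Sum>e\<in>F - F'. c e * x e)"
      by (subst sum.subset_diff[of F']) (auto simp: F'_def)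
    moreover have "(\<Sum>e\<in>F - F'. c e * x e) \<le> 0"
      using Cons(3) nonneg
      by (intro sum_nonpos mult_nonpos_nonneg) (auto simp: F'_def not_less)
    ultimately show ?thesis by linarith
  qed
  also have "\<dots> = (\<Sum>e\<in>F'. c' e * x e) + c st * sum x (F' \<inter> Z)"
    using finF' by (rule split)
  also have "(\<Sum>e\<in>F'. c' e * x e) = (\<Sum>e\<in>F' - {st}. c' e * x e)"
    using finF' st c'st by (simp add: sum.remove)
  also have "\<dots> + c st * sum x (F' \<inter> Z) \<le> \<theta> * sum c' M' + c st * \<theta>"
    using IH mass cst by (intro add_mono mult_left_mono) auto
  also have "c st * \<theta> \<le> c st * \<theta> * card (M \<inter> Z)"
    using mult_left_mono[OF meet, of "c st * \<theta>"] cst \<theta> by simp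
  also have "sum c' M' = sum c' M"
    using finM' M'_sub c'st by (simp add: M subset_Diff_insert)
  also have "\<theta> * sum c' M + c st * \<theta> * card (M \<inter> Z) = \<theta> * sum c M"
    using split[OF finM, of "\<lambda>_. 1"] by (simp add: algebra_simps)
  finally show ?case
    by (simp add: M_def)
qed

section \<open>The LP optimum as an upper bound for matchings\<close>

lemma sum_indicator_le_1:
  assumes "finite A" "\<And>e f. e \<in> A \<inter> M \<Longrightarrow> f \<in> A \<inter> M \<Longrightarrow> e = f"
  shows "sum (indicat_real M) A \<le> 1"
proof -
  have "card (A \<inter> M) \<le> Suc 0"
    using assms by (subst card_le_Suc0_iff_eq) auto
  then show ?thesis
    using assms(1) by (simp add: indicator_def sum.If_cases)
qed

text \<open>Both families of constraints hold because the edge set they sum over contains at most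
  one edge of \<open>M\<close>.\<close>

lemma LP1_feasible_indicator:
  assumes graph: "bipartite_graph n T E" and M: "distance_matching n d E M"
  shows "LP1_feasible n d T E (indicat_real M)"
  unfolding LP1_feasible_def
proof (intro conjI ballI)
  have finE: "finite E" using graph by (rule bipartite_graph_finite)
  have ME: "M \<subseteq> E" and card_M: "\<forall>s\<in>{1..n}. card (Delta_S M s) \<le> 1"
    and dist_M: "\<And>i j t. (i, t) \<in> M \<Longrightarrow> (j, t) \<in> M \<Longrightarrow> i \<noteq> j \<Longrightarrow> int d \<le> \<bar>int j - int i\<bar>"
    using M unfolding distance_matching_def by blast+
  show "0 \<le> indicat_real M e" for e by simp
  show "sum (indicat_real M) (Delta_S E s) \<le> 1" if s: "s \<in> {1..n}" for s
  proof (rule sum_indicator_le_1)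
    show "finite (Delta_S E s)" using finE by (simp add: Delta_S_def)
    have "finite (Delta_S M s)" using finE ME by (auto simp: Delta_S_def intro: finite_subset)
    then have "\<forall>e\<in>Delta_S M s. \<forall>f\<in>Delta_S M s. e = f"
      using card_M s by (simp flip: card_le_Suc0_iff_eq)
    then show "e = f" if "e \<in> Delta_S E s \<inter> M" "f \<in> Delta_S E s \<inter> M" for e f
      using that unfolding Delta_S_def by blast
  qed
  show "sum (indicat_real M) {e \<in> Delta_T E t. fst e \<in> R_window n d s} \<le> 1"
    if s: "s \<in> {1..n}" for s t
  proof (rule sum_indicator_le_1)
    show "finite {e \<in> Delta_T E t. fst e \<in> R_window n d s}"
      using finE by (simp add: Delta_T_def)
    show "e = f" if "e \<in> {e \<in> Delta_T E t. fst e \<in> R_window n d s} \<inter> M"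
      "f \<in> {e \<in> Delta_T E t. fst e \<in> R_window n d s} \<inter> M" for e f
    proof -
      define i j where "i = fst e" and "j = fst f"
      then have e: "e = (i, t)" and f: "f = (j, t)"
        using that by (auto simp: Delta_T_def prod_eq_iff)
      have "i = j"
      proof (rule ccontr)
        assume "i \<noteq> j"
        then have "int d \<le> \<bar>int j - int i\<bar>"
          using dist_M that e f by auto
        \<comment> \<open>Both indices lie between \<open>s\<close> and \<open>s + d - 1\<close>, so
          they differ by less than \<open>d\<close>; for \<open>d = 0\<close> the window is empty,
          as \<open>s\<close> is at least 1.\<close>
        then show False
          using that \<open>i \<noteq> j\<close> s by (auto simp: e f R_window_def)
      qed
      then show ?thesis by (simp add: e f)
    qed
  qed
qed

text \<open>Optimality of \<open>x\<close> enters here, by comparison with the feasible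
  characteristic vector of \<open>M\<close>.\<close>

lemma weight_le_LP1_optimal:
  assumes graph: "bipartite_graph n T E"
    and "LP1_optimal n d T E w x"
    and M: "distance_matching n d E M"
  shows "sum w M \<le> (\<Sum>e\<in>E. w e * x e)"
proof -
  have "M \<subseteq> E" using M by (simp add: distance_matching_def)
  then have "sum w M = (\<Sum>e\<in>E. w e * indicat_real M e)"
    using bipartite_graph_finite[OF graph] by (simp add: Int_absorb1)
  also have "\<dots> \<le> (\<Sum>e\<in>E. w e * x e)"
    using assms(2) LP1_feasible_indicator[OF graph M] by (simp add: LP1_optimal_def)
  finally show ?thesis .
qed

theorem theorem6:
  fixes n d :: nat and T :: "'t set" and E :: "'t edge set"
    and w x :: "'t edge \<Rightarrow> real" and \<theta> :: real and es :: "'t edge list"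
  assumes "bipartite_graph n T E"
    and "\<forall>e\<in>E. 0 \<le> w e"
    and "LP1_optimal n d T E w x"
    and "flat_ordering n d E x \<theta> es"
  shows "distance_matching n d E (wdm_lp_apx n d E es E w) \<and>
         (\<forall>M. distance_matching n d E M \<longrightarrow>
              \<theta> * (\<Sum>e\<in>wdm_lp_apx n d E es E w. w e) \<ge> (\<Sum>e\<in>M. w e))"
proof (intro conjI allI impI)
  show "distance_matching n d E (wdm_lp_apx n d E es E w)"
    by (rule distance_matching_wdm_lp_apx)
  fix M assume "distance_matching n d E M"
  then have "sum w M \<le> (\<Sum>e\<in>E. w e * x e)"
    using assms(1,3) by (intro weight_le_LP1_optimal)
  also have "\<dots> \<le> \<theta> * (\<Sum>e\<in>wdm_lp_apx n d E es E w. w e)"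
    using assms by (intro wdm_lp_apx_ge_LP_value) (auto simp: LP1_optimal_def LP1_feasible_def)
  finally show "sum w M \<le> \<theta> * (\<Sum>e\<in>wdm_lp_apx n d E es E w. w e)" .
qed

end
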